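(* Let $\mathcal H_A$ and $\mathcal H_B$ be two weighted B-hypergraphs on the same vertex set $V=\{1,\dots,N\}$, each coupled to the dynamics $$\dot x_i=f(x_i)+\sum_{k}\sum_{e=(T\to i)\in E_k} w(e)\,M\Big[\sigma\Big(\tfrac1k\sum_{j\in T}x_j\Big)-\sigma(x_i)\Big],\qquad i=1,\dots,N,$$ with the same $f$, $\sigma$, $M$ and the same homogeneous equilibrium $(\bar x,\dots,\bar x)$. If $\mathcal H_A$ and $\mathcal H_B$ are exposure-equivalent, i.e. $A^{(k)}(\mathcal H_A)=A^{(k)}(\mathcal H_B)$ for all $k$, then they induce identical linear operators (the same $L_{\mathrm{tot}}$, and the same Jacobian $I_N\otimes J_f-L_{\mathrm{tot}}\otimes D_{\mathrm{eff}}$ at the homogeneous equilibrium). In particular, they have identical spectra, dispersion relations, and Turing onset thresholds.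
   Context: A weighted B-hypergraph $\mathcal H=(V,E,w)$ consists of a finite set $E$ of B-arcs $e=(T\to i)$, with $T\subset V$ nonempty and $i\in V\setminus T$, and weights $w:E\to\mathbb R_{>0}$; $E_k$ is the set of B-arcs with $|T|=k$. Exposure matrix: $A^{(k)}_{ij}=\sum_{e=(T\to i)\in E_k,\ j\in T}w(e)/k$. In-degree: $d^{(k)}_{\mathrm{in}}(i)=\sum_{e=(T\to i)\in E_k}w(e)$. $L^{(k)}=\mathrm{diag}(d^{(k)}_{\mathrm{in}})-A^{(k)}$ and $L_{\mathrm{tot}}=\sum_k L^{(k)}$. Node states are $x_i\in\mathbb R^d$; $f,\sigma:\mathbb R^d\to\mathbb R^d$ are sufficiently smooth, $\sigma$ acts componentwise, $M\in\mathbb R^{d\times d}$, $f(\bar x)=0$, $J_f=Df(\bar x)$, $D_{\mathrm{eff}}=M\,D\sigma(\bar x)$. The generalized dispersion relation is $\omega(\lambda)=\max\{\Re(\nu):\nu\in\sigma(J_f-\lambda D_{\mathrm{eff}})\}$ (here $\sigma(\cdot)$ of a matrix is its spectrum), evaluated over $\lambda\in\sigma(L_{\mathrm{tot}})$. When $M$ depends on a control parameter $p$, instability (Turing) onset occurs at the values of $p$ for which $\max_{\lambda\in\sigma(L_{\mathrm{tot}})}\omega(\lambda)=0$. *)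

theory Defs
  imports "HOL-Analysis.Analysis"
begin

section \<open>Weighted B-hypergraphs\<close>

text \<open>
  The vertex set is the finite type \<open>'n\<close>, so that \<open>N = CARD('n)\<close>. A pair \<open>(T, i)\<close> is the
  B-arc \<open>T \<rightarrow> i\<close>. Weights outside \<open>arcs H\<close> are irrelevant.
\<close>

record 'n bhypergraph =
  arcs :: "('n set \<times> 'n) set"
  weight :: "'n set \<times> 'n \<Rightarrow> real"

definition weighted_bhypergraph :: "'n::finite bhypergraph \<Rightarrow> bool" where
  "weighted_bhypergraph H \<longleftrightarrow>
     finite (arcs H) \<and>
     (\<forall>(T, i) \<in> arcs H. T \<noteq> {} \<and> i \<notin> T) \<and>
     (\<forall>e \<in> arcs H. weight H e > 0)"

definition arcs_of_size :: "'n::finite bhypergraph \<Rightarrow> nat \<Rightarrow> ('n set \<times> 'n) set" where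
  "arcs_of_size H k = {e \<in> arcs H. card (fst e) = k}"

definition exposure :: "'n::finite bhypergraph \<Rightarrow> nat \<Rightarrow> real^'n^'n" where
  "exposure H k =
     (\<chi> i j. \<Sum>e \<in> {e \<in> arcs_of_size H k. snd e = i \<and> j \<in> fst e}. weight H e / real k)"

definition in_degree :: "'n::finite bhypergraph \<Rightarrow> nat \<Rightarrow> 'n \<Rightarrow> real" where
  "in_degree H k i = (\<Sum>e \<in> {e \<in> arcs_of_size H k. snd e = i}. weight H e)"

definition laplacian :: "'n::finite bhypergraph \<Rightarrow> nat \<Rightarrow> real^'n^'n" where
  "laplacian H k = (\<chi> i j. if i = j then in_degree H k i else 0) - exposure H k"

text \<open>Tails are nonempty subsets of the vertex set, so only the sizes \<open>1..N\<close> can occur.\<close>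

definition total_laplacian :: "'n::finite bhypergraph \<Rightarrow> real^'n^'n" where
  "total_laplacian H = (\<Sum>k = 1..CARD('n). laplacian H k)"

definition exposure_equivalent :: "'n::finite bhypergraph \<Rightarrow> 'n bhypergraph \<Rightarrow> bool" where
  "exposure_equivalent H H' \<longleftrightarrow> (\<forall>k. exposure H k = exposure H' k)"

section \<open>The coupled dynamics\<close>

definition C1 :: "(real^'d \<Rightarrow> real^'d) \<Rightarrow> bool" where
  "C1 g \<longleftrightarrow>
     (\<forall>x. g differentiable (at x)) \<and> continuous_on UNIV (\<lambda>x. jacobian g (at x))"

text \<open>The scalar function may differ from component to component.\<close>

definition acts_componentwise :: "(real^'d \<Rightarrow> real^'d) \<Rightarrow> bool" where
  "acts_componentwise g \<longleftrightarrow> (\<exists>s :: 'd \<Rightarrow> real \<Rightarrow> real. \<forall>x a. g x $ a = s a (x $ a))"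

text \<open>
  The state of the whole network is a single vector in \<open>\<real>\<^bsup>Nd\<^esup>\<close>, indexed by pairs (node, component);
  thus its Jacobian matrix has the index set of a Kronecker product.
\<close>

definition node_state :: "real^('n::finite \<times> 'd::finite) \<Rightarrow> 'n \<Rightarrow> real^'d" where
  "node_state x i = (\<chi> a. x $ (i, a))"

definition homogeneous_state :: "real^'d::finite \<Rightarrow> real^('n::finite \<times> 'd)" where
  "homogeneous_state xbar = (\<chi> p. xbar $ snd p)"

definition node_rhs ::
  "'n::finite bhypergraph \<Rightarrow> (real^'d \<Rightarrow> real^'d) \<Rightarrow> (real^'d \<Rightarrow> real^'d) \<Rightarrow> real^'d^'d
   \<Rightarrow> real^('n \<times> 'd::finite) \<Rightarrow> 'n \<Rightarrow> real^'d" where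
  "node_rhs H f \<sigma> M x i =
     f (node_state x i) +
     (\<Sum>k = 1..CARD('n). \<Sum>e \<in> {e \<in> arcs_of_size H k. snd e = i}.
        weight H e *\<^sub>R
          (M *v (\<sigma> ((1 / real k) *\<^sub>R (\<Sum>j \<in> fst e. node_state x j)) - \<sigma> (node_state x i))))"

definition vector_field ::
  "'n::finite bhypergraph \<Rightarrow> (real^'d \<Rightarrow> real^'d) \<Rightarrow> (real^'d \<Rightarrow> real^'d) \<Rightarrow> real^'d^'d
   \<Rightarrow> real^('n \<times> 'd::finite) \<Rightarrow> real^('n \<times> 'd)" where
  "vector_field H f \<sigma> M x = (\<chi> p. node_rhs H f \<sigma> M x (fst p) $ snd p)"

section \<open>Linearization, spectra and dispersion relation\<close>

definition kronecker :: "real^'n^'n \<Rightarrow> real^'d^'d \<Rightarrow> real^('n::finite \<times> 'd::finite)^('n \<times> 'd)" where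
  "kronecker A B = (\<chi> p q. A $ fst p $ fst q * B $ snd p $ snd q)"

definition D_eff :: "(real^'d \<Rightarrow> real^'d) \<Rightarrow> real^'d^'d \<Rightarrow> real^'d::finite \<Rightarrow> real^'d^'d" where
  "D_eff \<sigma> M xbar = M ** jacobian \<sigma> (at xbar)"

definition spectrum :: "complex^'m^'m \<Rightarrow> complex set" where
  "spectrum A = {\<nu>. \<exists>v. v \<noteq> 0 \<and> A *v v = \<nu> *s v}"

definition complexify :: "real^'m^'m \<Rightarrow> complex^'m^'m" where
  "complexify A = map_matrix complex_of_real A"

text \<open>
  \<open>J\<close> and \<open>D\<close> stand for \<open>Df(xbar)\<close> and the effective diffusion matrix. The spectrum of a complex
  square matrix is finite and nonempty, so the maxima below are attained. The parameter
  \<open>\<mu>\<close> is complex because the Laplacian need not be symmetric.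
\<close>

definition dispersion :: "real^'d^'d \<Rightarrow> real^'d^'d \<Rightarrow> complex \<Rightarrow> real" where
  "dispersion J D \<mu> = Max (Re ` spectrum (complexify J - map_matrix ((*) \<mu>) (complexify D)))"

text \<open>The graph of \<open>\<mu> \<mapsto> \<omega>(\<mu>)\<close> on the spectrum of the total Laplacian.\<close>

definition dispersion_relation ::
  "'n::finite bhypergraph \<Rightarrow> (real^'d \<Rightarrow> real^'d) \<Rightarrow> (real^'d \<Rightarrow> real^'d) \<Rightarrow> real^'d^'d
   \<Rightarrow> real^'d::finite \<Rightarrow> (complex \<times> real) set" where
  "dispersion_relation H f \<sigma> M xbar =
     {(\<mu>, dispersion (jacobian f (at xbar)) (D_eff \<sigma> M xbar) \<mu>) | \<mu>.
        \<mu> \<in> spectrum (complexify (total_laplacian H))}"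

text \<open>Here the coupling matrix \<open>M\<close> depends on a control parameter.\<close>

definition turing_onset ::
  "'n::finite bhypergraph \<Rightarrow> (real^'d \<Rightarrow> real^'d) \<Rightarrow> (real^'d \<Rightarrow> real^'d) \<Rightarrow> ('p \<Rightarrow> real^'d^'d)
   \<Rightarrow> real^'d::finite \<Rightarrow> 'p set" where
  "turing_onset H f \<sigma> M xbar =
     {p. Max (dispersion (jacobian f (at xbar)) (D_eff \<sigma> (M p) xbar) `
              spectrum (complexify (total_laplacian H))) = 0}"

end

theory Submission
  imports Defs
begin

text \<open>
  The in-degree of \<open>i\<close> in \<open>E\<^sub>k\<close> is the \<open>i\<close>-th row sum of the exposure matrix, since an
  arc of size \<open>k\<close> contributes \<open>w(e)/k\<close> to exactly \<open>k\<close> entries; so the exposure matrices determine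
  the Laplacians. At a homogeneous state every tail average equals \<open>xbar\<close>, so the chain rule
  evaluates all derivatives of \<open>\<sigma>\<close> at the same point and the linearized coupling factors through
  \<open>M ** D\<sigma>(xbar)\<close> and the total Laplacian.
\<close>

text \<open>For \<open>k = 0\<close> the tails are empty: the exposure row vanishes while the
  in-degree may not, hence the assumption.\<close>

lemma exposure_row_sum:
  assumes "k \<noteq> 0"
  shows "(\<Sum>j\<in>UNIV. exposure H k $ i $ j) = in_degree H k i"
proof -
  let ?S = "{e \<in> arcs_of_size H k. snd e = i}"
  have "(\<Sum>j\<in>UNIV. exposure H k $ i $ j) =
      (\<Sum>j\<in>UNIV. \<Sum>e\<in>?S. if j \<in> fst e then weight H e / real k else 0)"
    by (simp add: exposure_def sum.If_cases Int_def conj_assoc)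
  also have "\<dots> = (\<Sum>e\<in>?S. \<Sum>j\<in>UNIV. if j \<in> fst e then weight H e / real k else 0)"
    by (rule sum.swap)
  also have "\<dots> = (\<Sum>e\<in>?S. weight H e)"
    using assms by (intro sum.cong) (auto simp: sum.If_cases arcs_of_size_def)
  finally show ?thesis
    by (simp add: in_degree_def)
qed

lemma exposure_equivalent_imp_total_laplacian_eq:
  assumes "exposure_equivalent H H'"
  shows "total_laplacian H = total_laplacian H'"
proof -
  \<comment> \<open>Excluding \<open>k = 0\<close> costs nothing, as \<open>total_laplacian\<close>
    sums over sizes from 1 on.\<close>
  have "laplacian H k = laplacian H' k" if "k \<noteq> 0" for k
  proof -
    have "in_degree H k i = in_degree H' k i" for i
      using assms exposure_row_sum[OF that] by (metis exposure_equivalent_def)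
    then show ?thesis
      using assms by (simp add: laplacian_def exposure_equivalent_def cong: if_cong)
  qed
  then show ?thesis
    unfolding total_laplacian_def by (intro sum.cong) auto
qed

text \<open>Exchanging the sums over nodes and arcs turns the matrix action into weighted tail
  averages. At \<open>k = 0\<close> both sides vanish because division by zero gives zero. The
  values \<open>y j\<close> are vectors, so that node states can be inserted later.\<close>

lemma exposure_sum:
  fixes y :: "'n::finite \<Rightarrow> 'a::real_vector"
  shows "(\<Sum>j\<in>UNIV. exposure H k $ i $ j *\<^sub>R y j) =
    (\<Sum>e \<in> {e \<in> arcs_of_size H k. snd e = i}.
       weight H e *\<^sub>R (1 / real k) *\<^sub>R (\<Sum>j\<in>fst e. y j))"
proof -
  let ?S = "{e \<in> arcs_of_size H k. snd e = i}"
  have "(\<Sum>j\<in>UNIV. exposure H k $ i $ j *\<^sub>R y j) =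
      (\<Sum>j\<in>UNIV. \<Sum>e\<in>?S. if j \<in> fst e then (weight H e / real k) *\<^sub>R y j else 0)"
    by (simp add: exposure_def sum.If_cases Int_def conj_assoc scaleR_left.sum)
  also have "\<dots> = (\<Sum>e\<in>?S. \<Sum>j\<in>UNIV. if j \<in> fst e then (weight H e / real k) *\<^sub>R y j else 0)"
    by (rule sum.swap)
  also have "\<dots> = (\<Sum>e\<in>?S. weight H e *\<^sub>R (1 / real k) *\<^sub>R (\<Sum>j\<in>fst e. y j))"
    by (simp add: sum.If_cases scaleR_sum_right)
  finally show ?thesis .
qed

text \<open>The diagonal contributes \<open>y i\<close> once per arc into \<open>i\<close>, with
  that arc's weight, so it pairs with the tail average arc by arc. The right-hand side is the
  coupling term of \<open>node_rhs\<close> with \<open>M\<close> and \<sigma> stripped off.\<close>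

lemma laplacian_sum:
  fixes y :: "'n::finite \<Rightarrow> 'a::real_vector"
  shows "(\<Sum>j\<in>UNIV. laplacian H k $ i $ j *\<^sub>R y j) =
    - (\<Sum>e \<in> {e \<in> arcs_of_size H k. snd e = i}.
        weight H e *\<^sub>R ((1 / real k) *\<^sub>R (\<Sum>j\<in>fst e. y j) - y i))"
proof -
  have "(\<Sum>j\<in>UNIV. laplacian H k $ i $ j *\<^sub>R y j) =
      (\<Sum>j\<in>UNIV. if j = i then in_degree H k i *\<^sub>R y i else 0) -
      (\<Sum>j\<in>UNIV. exposure H k $ i $ j *\<^sub>R y j)"
    unfolding sum_subtractf[symmetric]
    by (intro sum.cong) (auto simp: laplacian_def scaleR_diff_left)
  then show ?thesis
    by (simp add: exposure_sum in_degree_def scaleR_left.sum scaleR_diff_right sum_subtractf)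
qed

lemma total_laplacian_sum:
  fixes y :: "'n::finite \<Rightarrow> 'a::real_vector"
  shows "(\<Sum>j\<in>UNIV. total_laplacian H $ i $ j *\<^sub>R y j) =
    - (\<Sum>k = 1..CARD('n). \<Sum>e \<in> {e \<in> arcs_of_size H k. snd e = i}.
        weight H e *\<^sub>R ((1 / real k) *\<^sub>R (\<Sum>j\<in>fst e. y j) - y i))"
proof -
  have "(\<Sum>j\<in>UNIV. total_laplacian H $ i $ j *\<^sub>R y j) =
      (\<Sum>k = 1..CARD('n). \<Sum>j\<in>UNIV. laplacian H k $ i $ j *\<^sub>R y j)"
    unfolding total_laplacian_def sum_component scaleR_left.sum by (rule sum.swap)
  then show ?thesis
    by (simp only: laplacian_sum sum_negf)
qed

text \<open>Summing over nodes first leaves a row of \<open>A\<close> acting on whole node states,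
  the form in which \<open>total_laplacian_sum\<close> applies.\<close>

lemma kronecker_mult_vector_nth:
  "(kronecker A B *v x) $ (i, a) = (B *v (\<Sum>j\<in>UNIV. A $ i $ j *\<^sub>R node_state x j)) $ a"
proof -
  have "(kronecker A B *v x) $ (i, a) =
      (\<Sum>j\<in>UNIV. \<Sum>b\<in>UNIV. A $ i $ j * B $ a $ b * x $ (j, b))"
    \<comment> \<open>Reversing \<open>UNIV_Times_UNIV\<close> exposes the sum over the pair type as
      a double sum; the forward rule is removed to avoid a loop.\<close>
    by (simp add: matrix_vector_mult_def kronecker_def sum.cartesian_product UNIV_Times_UNIV[symmetric]
        case_prod_beta del: UNIV_Times_UNIV)
  also have "\<dots> = (\<Sum>b\<in>UNIV. \<Sum>j\<in>UNIV. A $ i $ j * B $ a $ b * x $ (j, b))"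
    by (rule sum.swap)
  finally show ?thesis
    by (simp add: matrix_vector_mult_def node_state_def sum_distrib_left mult_ac)
qed

lemma kronecker_mat_1_mult_vector_nth:
  "(kronecker (mat 1) B *v x) $ (i, a) = (B *v node_state x i) $ a"
proof -
  have "(\<Sum>j\<in>UNIV. mat 1 $ i $ j *\<^sub>R node_state x j) =
      (\<Sum>j\<in>UNIV. if j = i then node_state x i else 0)"
    by (intro sum.cong) (auto simp: mat_def)
  then show ?thesis
    by (simp add: kronecker_mult_vector_nth)
qed

lemma node_state_homogeneous_state [simp]: "node_state (homogeneous_state xbar) i = xbar"
  by (simp add: node_state_def homogeneous_state_def vec_eq_iff)

text \<open>Reading off a node is linear, hence bounded in finite dimension, hence its own
  derivative.\<close>

lemma has_derivative_node_state [derivative_intros]: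
  "((\<lambda>x. node_state x i) has_derivative (\<lambda>h. node_state h i)) F"
  by (intro bounded_linear_imp_has_derivative linear_linear[THEN iffD2] linearI)
    (auto simp: node_state_def vec_eq_iff)

lemma has_derivative_vec_componentwise:
  fixes f :: "'a::real_normed_vector \<Rightarrow> real^'n"
  assumes "\<And>i. ((\<lambda>x. f x $ i) has_derivative (\<lambda>h. f' h $ i)) (at x within S)"
  shows "(f has_derivative f') (at x within S)"
  using assms
  by (subst has_derivative_componentwise_within) (auto simp: Basis_vec_def inner_axis)

text \<open>Uniqueness of the derivative identifies \<open>frechet_derivative\<close>; the entries
  of \<open>A\<close> are then recovered from the axis vectors.\<close>

lemma jacobian_eqI:
  assumes "(f has_derivative (\<lambda>h. A *v h)) (at x)"
  shows "jacobian f (at x) = A"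
  unfolding jacobian_def frechet_derivative_at[OF assms, symmetric]
  by (simp add: matrix_def matrix_vector_mult_def axis_def vec_eq_iff if_distrib cong: if_cong)

lemma has_derivative_node_rhs:
  fixes H :: "'n::finite bhypergraph" and f \<sigma> :: "real^'d::finite \<Rightarrow> real^'d"
  assumes f: "f differentiable (at xbar)" and \<sigma>: "\<sigma> differentiable (at xbar)"
  shows "((\<lambda>x. node_rhs H f \<sigma> M x i) has_derivative
     (\<lambda>h. jacobian f (at xbar) *v node_state h i -
       D_eff \<sigma> M xbar *v (\<Sum>j\<in>UNIV. total_laplacian H $ i $ j *\<^sub>R node_state h j)))
     (at (homogeneous_state xbar))"
proof -
  let ?x0 = "homogeneous_state xbar :: real^('n \<times> 'd)"
  let ?J = "jacobian \<sigma> (at xbar)"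
  let ?avg = "\<lambda>k e h. (1 / real k) *\<^sub>R (\<Sum>j\<in>fst e. node_state h j)"
  have comp: "((\<lambda>x. g (u x)) has_derivative (\<lambda>h. jacobian g (at xbar) *v u' h)) (at ?x0)"
    if g: "g differentiable (at xbar)" and "(u has_derivative u') (at ?x0)" and "u ?x0 = xbar"
    for g :: "real^'d \<Rightarrow> real^'d" and u u'
    using diff_chain_at[of u u' ?x0 g "\<lambda>h. jacobian g (at xbar) *v h"] that
    by (simp add: jacobian_works o_def)
  have arc: "((\<lambda>x. weight H e *\<^sub>R (M *v (\<sigma> (?avg k e x) - \<sigma> (node_state x i)))) has_derivative
      (\<lambda>h. weight H e *\<^sub>R (M *v (?J *v ?avg k e h - ?J *v node_state h i)))) (at ?x0)"
    if "k \<noteq> 0" "e \<in> arcs_of_size H k" for k e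
  proof -
    have "card (fst e) = k"
      using that by (simp add: arcs_of_size_def)
    \<comment> \<open>A sum of \<open>k\<close> copies of \<open>xbar\<close>, scaled by
      \<open>1 / real k\<close>; this is where \<open>k \<noteq> 0\<close> enters.\<close>
    then have "?avg k e ?x0 = xbar"
      using that by (simp add: sum_constant_scaleR del: sum_constant)
    then show ?thesis
      by (intro has_derivative_scaleR_right comp \<sigma> has_derivative_diff has_derivative_sum
          has_derivative_node_state bounded_linear.has_derivative[OF matrix_vector_mul_bounded_linear])
        auto
  qed
  have "((\<lambda>x. node_rhs H f \<sigma> M x i) has_derivative
      (\<lambda>h. jacobian f (at xbar) *v node_state h i +
        (\<Sum>k = 1..CARD('n). \<Sum>e \<in> {e \<in> arcs_of_size H k. snd e = i}.
          weight H e *\<^sub>R (M *v (?J *v ?avg k e h - ?J *v node_state h i))))) (at ?x0)"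
    unfolding node_rhs_def
    by (intro has_derivative_add has_derivative_sum comp f has_derivative_node_state arc) auto
  moreover have "(\<Sum>k = 1..CARD('n). \<Sum>e \<in> {e \<in> arcs_of_size H k. snd e = i}.
          weight H e *\<^sub>R (M *v (?J *v ?avg k e h - ?J *v node_state h i))) =
      - (D_eff \<sigma> M xbar *v (\<Sum>j\<in>UNIV. total_laplacian H $ i $ j *\<^sub>R node_state h j))" for h
    \<comment> \<open>Splitting the product as \<open>M\<close> after \<open>?J\<close> lets
      linearity carry both inside the sums over sizes and arcs, where the two sides agree.\<close>
    unfolding total_laplacian_sum D_eff_def
    by (simp add: linear_neg[OF matrix_vector_mul_linear] linear_sum[OF matrix_vector_mul_linear]
        matrix_vector_mult_scaleR matrix_vector_mul_assoc[symmetric] matrix_vector_mult_diff_distrib)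
  ultimately show ?thesis
    by simp
qed

lemma has_derivative_vector_field:
  fixes H :: "'n::finite bhypergraph" and f \<sigma> :: "real^'d::finite \<Rightarrow> real^'d"
  assumes "f differentiable (at xbar)" and "\<sigma> differentiable (at xbar)"
  shows "(vector_field H f \<sigma> M has_derivative
     (\<lambda>h. (kronecker (mat 1) (jacobian f (at xbar)) -
       kronecker (total_laplacian H) (D_eff \<sigma> M xbar)) *v h)) (at (homogeneous_state xbar))"
proof (rule has_derivative_vec_componentwise)
  fix p :: "'n \<times> 'd"
  obtain i a where p: "p = (i, a)"
    by (cases p)
  show "((\<lambda>x. vector_field H f \<sigma> M x $ p) has_derivative
     (\<lambda>h. ((kronecker (mat 1) (jacobian f (at xbar)) -
       kronecker (total_laplacian H) (D_eff \<sigma> M xbar)) *v h) $ p)) (at (homogeneous_state xbar))"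
    using bounded_linear.has_derivative[OF bounded_linear_vec_nth has_derivative_node_rhs[OF assms]]
    \<comment> \<open>Instantiating the general rule at the Laplacian keeps it off the
      \<open>mat 1\<close> block, which has its own simpler rule.\<close>
    by (simp add: p vector_field_def matrix_vector_mult_diff_rdistrib
        kronecker_mat_1_mult_vector_nth kronecker_mult_vector_nth[of "total_laplacian H"])
qed

theorem corollary4p9:
  fixes H\<^sub>A H\<^sub>B :: "'n::finite bhypergraph"
    and f \<sigma> :: "real^'d::finite \<Rightarrow> real^'d"
    and M :: "real^'d^'d"
    and M_param :: "'p \<Rightarrow> real^'d^'d"
    and xbar :: "real^'d"
  assumes "weighted_bhypergraph H\<^sub>A" and "weighted_bhypergraph H\<^sub>B"
    and "C1 f" and "C1 \<sigma>" and "acts_componentwise \<sigma>"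
    and "f xbar = 0"
    and "exposure_equivalent H\<^sub>A H\<^sub>B"
  shows "let x0 = homogeneous_state xbar :: real^('n \<times> 'd);
             F\<^sub>A = vector_field H\<^sub>A f \<sigma> M;
             F\<^sub>B = vector_field H\<^sub>B f \<sigma> M
         in total_laplacian H\<^sub>A = total_laplacian H\<^sub>B \<and>
            F\<^sub>A differentiable (at x0) \<and> F\<^sub>B differentiable (at x0) \<and>
            jacobian F\<^sub>A (at x0) =
              kronecker (mat 1) (jacobian f (at xbar)) -
              kronecker (total_laplacian H\<^sub>A) (D_eff \<sigma> M xbar) \<and>
            jacobian F\<^sub>B (at x0) =
              kronecker (mat 1) (jacobian f (at xbar)) -
              kronecker (total_laplacian H\<^sub>B) (D_eff \<sigma> M xbar) \<and>
            jacobian F\<^sub>A (at x0) = jacobian F\<^sub>B (at x0) \<and>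
            spectrum (complexify (total_laplacian H\<^sub>A)) =
              spectrum (complexify (total_laplacian H\<^sub>B)) \<and>
            spectrum (complexify (jacobian F\<^sub>A (at x0))) =
              spectrum (complexify (jacobian F\<^sub>B (at x0))) \<and>
            dispersion_relation H\<^sub>A f \<sigma> M xbar = dispersion_relation H\<^sub>B f \<sigma> M xbar \<and>
            turing_onset H\<^sub>A f \<sigma> M_param xbar = turing_onset H\<^sub>B f \<sigma> M_param xbar"
proof -
  have diff: "f differentiable (at xbar)" "\<sigma> differentiable (at xbar)"
    using assms by (auto simp: C1_def)
  note deriv = has_derivative_vector_field[OF diff, where M = M]
  have "vector_field H f \<sigma> M differentiable (at (homogeneous_state xbar))"
    for H :: "'n bhypergraph"
    using deriv by (auto simp: differentiable_def)
  then show ?thesis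
    \<comment> \<open>Every remaining quantity depends on the hypergraph only through
      \<open>total_laplacian\<close>, the Jacobian by its explicit formula.\<close>
    using exposure_equivalent_imp_total_laplacian_eq[OF assms(7)]
    by (simp add: jacobian_eqI[OF deriv] dispersion_relation_def turing_onset_def)
qed

end
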